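(* Consider the connectivity maintenance on a closed cycle problem with input a real $r>0$, a closed cycle $\mathcal{C}$ of length $|\mathcal{C}|\le nr$, and a set of $n$ points $p_1,\dots,p_n$ on $\mathcal{C}$, given in clockwise order by their coordinates $0=x_1<x_2<\dots<x_n<|\mathcal{C}|$. The two-stage algorithm described in the context finds an optimal solution of this problem in $O(n)$ time. That is, its output is a solution whose maximum moving distance over all points is the minimum among all solutions, and its running time is $O(n)$.
   Context: Setting. $\mathcal{C}$ is a closed cycle of length $|\mathcal{C}|>0$. The coordinate of a location on $\mathcal{C}$ is its clockwise distance from the initial position of $p_1$, taken in $[0,|\mathcal{C}|)$. For coordinates $a,b$, let $c(a,b)$ be the clockwise distance from $a$ to $b$: $c(a,b)=b-a$ if $a\le b$, and $c(a,b)=|\mathcal{C}|-(a-b)$ if $a>b$. Points move only along $\mathcal{C}$. The problem. Points keep their cyclic order. A solution is a vector of signed displacements $(\delta_1,\dots,\delta_n)\in\mathbb{R}^n$ (positive means clockwise, negative means counterclockwise) such that, with $y_i=x_i+\delta_i$ (positions on the unrolled cycle), one has $0\le y_{i+1}-y_i\le r$ for $1\le i<n$ and $0\le y_1+|\mathcal{C}|-y_n\le r$. Thus every adjacent pair of points, including $p_n,p_1$, is at distance at most $r$ going around the cycle. The moving distance of $p_i$ is $|\delta_i|$. A solution is optimal if it minimizes $\max_{1\le i\le n}|\delta_i|$ among all solutions. The algorithm. Stage 1 (one-direction moving stage; points are moved only counterclockwise). First round: set $x'_1=x_1=0$ and $d_{\max}=0$. For $i=1,\dots,n-1$: if $c(x'_i,x_{i+1})\le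 r$, set $x'_{i+1}=x_{i+1}$; otherwise set $x'_{i+1}=x'_i+r$ and replace $d_{\max}$ by $\max\{d_{\max},\,c(x'_i,x_{i+1})-r\}$. Second round: if $c(x'_n,x'_1)\le r$, Stage 1 ends. Otherwise set $x''_1=(x'_n+r)\bmod|\mathcal{C}|$ and replace $d_{\max}$ by $\max\{d_{\max},\,c(x'_n,x'_1)-r\}$. Then for $i=1,2,\dots,n-1$: if $c(x''_i,x'_{i+1})>r$, set $x''_{i+1}=(x''_i+r)\bmod|\mathcal{C}|$ (moving $p_{i+1}$ counterclockwise) and replace $d_{\max}$ by $\max\{d_{\max},\,c(x''_i,x_{i+1})-r\}$; otherwise set $x''_{i+1}=x'_{i+1}$. Stage 1 ends as soon as a point $p_k$ with $x''_k=x'_k=x_k$ is met. Let $m_i\ge 0$ be the total counterclockwise distance $p_i$ has been moved in Stage 1. Stage 2 (adjusting stage): move all points clockwise by $d_{\max}/2$. The output is the displacement vector $\delta_i=d_{\max}/2-m_i$. Model of computation: arithmetic operations and comparisons on real numbers each take constant time. *)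

theory Defs
  imports
    Complex_Main
    "HOL-Library.Landau_Symbols"
    "HOL-Library.Monad_Syntax"
    "HOL-Library.Real_Mod"
begin

section \<open>The problem\<close>

text \<open>
  Points are listed in clockwise order, and list positions start at 0:
  the coordinate of the point \<open>p\<^sub>i\<close> is \<open>xs ! (i - 1)\<close>.
  No explicit assumption \<open>n \<ge> 1\<close> is needed, since \<open>0 < L \<le> n * r\<close> implies it.
\<close>

definition cycle_instance :: "nat \<Rightarrow> real \<Rightarrow> real \<Rightarrow> real list \<Rightarrow> bool" where
  "cycle_instance n L r xs \<longleftrightarrow>
     0 < r \<and> 0 < L \<and> L \<le> real n * r \<and>
     length xs = n \<and> xs ! 0 = 0 \<and> sorted_wrt (<) xs \<and> (\<forall>x\<in>set xs. x < L)"

definition cycle_solution :: "real \<Rightarrow> real \<Rightarrow> real list \<Rightarrow> real list \<Rightarrow> bool" where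
  "cycle_solution L r xs ds \<longleftrightarrow>
     length ds = length xs \<and>
     (let n = length xs; y = (\<lambda>i. xs ! i + ds ! i) in
       (\<forall>i. i + 1 < n \<longrightarrow> 0 \<le> y (i + 1) - y i \<and> y (i + 1) - y i \<le> r) \<and>
       0 \<le> y 0 + L - y (n - 1) \<and> y 0 + L - y (n - 1) \<le> r)"

definition max_moving_distance :: "real list \<Rightarrow> real" where
  "max_moving_distance ds = Max ((\<lambda>d. \<bar>d\<bar>) ` set ds)"

definition optimal_solution :: "real \<Rightarrow> real \<Rightarrow> real list \<Rightarrow> real list \<Rightarrow> bool" where
  "optimal_solution L r xs ds \<longleftrightarrow>
     is_arg_min max_moving_distance (cycle_solution L r xs) ds"

definition cw_dist :: "real \<Rightarrow> real \<Rightarrow> real \<Rightarrow> real" where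
  "cw_dist L a b = (if a \<le> b then b - a else L - (a - b))"


section \<open>Computations with running time\<close>

text \<open>
  A value together with the number of elementary steps spent on computing it.
  Below, every arithmetic operation and comparison on reals is charged one step.
  Every call of a function that inspects the input list or recurses over a list is charged one
  more step; it stands for the bounded number of list-cell accesses, allocations and
  branches on Boolean values performed by that call outside of its recursive call.
\<close>

datatype 'a timed = Timed (val: 'a) (steps: nat)

definition return :: "'a \<Rightarrow> 'a timed" where
  "return a = Timed a 0"

definition bind_timed :: "'a timed \<Rightarrow> ('a \<Rightarrow> 'b timed) \<Rightarrow> 'b timed" where
  "bind_timed c f = Timed (val (f (val c))) (steps c + steps (f (val c)))"

adhoc_overloading Monad_Syntax.bind \<rightleftharpoons> bind_timed

definition tick :: "unit timed" where
  "tick = Timed () 1"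

definition add_t :: "real \<Rightarrow> real \<Rightarrow> real timed" where
  "add_t a b = Timed (a + b) 1"

definition sub_t :: "real \<Rightarrow> real \<Rightarrow> real timed" where
  "sub_t a b = Timed (a - b) 1"

definition div_t :: "real \<Rightarrow> real \<Rightarrow> real timed" where
  "div_t a b = Timed (a / b) 1"

definition le_t :: "real \<Rightarrow> real \<Rightarrow> bool timed" where
  "le_t a b = Timed (a \<le> b) 1"

definition eq_t :: "real \<Rightarrow> real \<Rightarrow> bool timed" where
  "eq_t a b = Timed (a = b) 1"

lemma val_steps_simps [simp]:
  "val (return a) = a" "steps (return a) = 0"
  "val (bind_timed c f) = val (f (val c))"
  "steps (bind_timed c f) = steps c + steps (f (val c))"
  "val tick = ()" "steps tick = 1"
  "val (add_t u v) = u + v" "steps (add_t u v) = 1"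
  "val (sub_t u v) = u - v" "steps (sub_t u v) = 1"
  "val (div_t u v) = u / v" "steps (div_t u v) = 1"
  "val (le_t u v) = (u \<le> v)" "steps (le_t u v) = 1"
  "val (eq_t u v) = (u = v)" "steps (eq_t u v) = 1"
  by (simp_all add: return_def bind_timed_def tick_def add_t_def sub_t_def div_t_def
      le_t_def eq_t_def)

definition max_t :: "real \<Rightarrow> real \<Rightarrow> real timed" where
  "max_t a b = do { c \<leftarrow> le_t a b; return (if c then b else a) }"

lemma val_max_t: "val (max_t a b) = max a b"
  by (simp add: max_t_def max_def)

definition cw_dist_t :: "real \<Rightarrow> real \<Rightarrow> real \<Rightarrow> real timed" where
  "cw_dist_t L a b = do {
     c \<leftarrow> le_t a b;
     if c then sub_t b a else do { d \<leftarrow> sub_t a b; sub_t L d } }"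

lemma val_cw_dist_t: "val (cw_dist_t L a b) = cw_dist L a b"
  by (simp add: cw_dist_t_def cw_dist_def)

text \<open>
  Addition modulo the length of the cycle, by a conditional subtraction: a remainder operation on
  reals would provide a floor function at unit cost. The algorithm only adds \<open>r\<close> to a coordinate
  when some clockwise distance exceeds \<open>r\<close>, so that \<open>r < L\<close> and the lemma below applies.
\<close>

definition add_mod_t :: "real \<Rightarrow> real \<Rightarrow> real \<Rightarrow> real timed" where
  "add_mod_t L a b = do {
     s \<leftarrow> add_t a b;
     c \<leftarrow> le_t L s;
     if c then sub_t s L else return s }"

lemma val_add_mod_t:
  assumes "0 \<le> a" "a < L" "0 \<le> b" "b < L"
  shows "val (add_mod_t L a b) = (a + b) rmod L"
proof (cases "L \<le> a + b")
  case True
  have "(a + b) rmod L = a + b - L"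
    by (rule rmod_unique[where n = 1]) (use assms True in auto)
  with True show ?thesis by (simp add: add_mod_t_def)
next
  case False
  have "(a + b) rmod L = a + b"
    by (rule rmod_unique[where n = 0]) (use assms False in auto)
  with False show ?thesis by (simp add: add_mod_t_def)
qed


section \<open>The algorithm\<close>

text \<open>
  A point is stored as a triple \<open>(x, p, m)\<close> of its initial coordinate, its current coordinate and
  the total counterclockwise distance it has been moved so far. Moving a point counterclockwise
  from \<open>p\<close> to \<open>p'\<close> adds \<open>cw_dist L p' p\<close> to \<open>m\<close>.

  \<open>first_round L r a d xs\<close> treats the points with initial coordinates \<open>xs\<close>, where \<open>a\<close> is the
  new coordinate of the preceding point and \<open>d\<close> the current value of \<open>d\<^sub>m\<^sub>a\<^sub>x\<close>.
  It returns these points, the new coordinate of the last point, and \<open>d\<^sub>m\<^sub>a\<^sub>x\<close>.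
\<close>

type_synonym point_state = "real \<times> real \<times> real"

fun first_round ::
  "real \<Rightarrow> real \<Rightarrow> real \<Rightarrow> real \<Rightarrow> real list \<Rightarrow> (point_state list \<times> real \<times> real) timed" where
  "first_round L r a d [] = do { tick; return ([], a, d) }"
| "first_round L r a d (x # xs) = do {
     tick;
     g \<leftarrow> cw_dist_t L a x;
     near \<leftarrow> le_t g r;
     if near then do {
       (ps, last, d') \<leftarrow> first_round L r x d xs;
       return ((x, x, 0) # ps, last, d') }
     else do {
       p \<leftarrow> add_t a r;
       e \<leftarrow> sub_t g r;
       d1 \<leftarrow> max_t d e;
       m \<leftarrow> cw_dist_t L p x;
       (ps, last, d') \<leftarrow> first_round L r p d1 xs;
       return ((x, p, m) # ps, last, d') } }"

text \<open>
  In \<open>second_round L r a d ps\<close>, the list \<open>ps\<close> contains the points as left by the first round,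
  and \<open>a\<close> is the new coordinate of the point preceding them. The round ends at the first
  point that neither round has moved; the remaining points are returned unchanged.
\<close>

fun second_round ::
  "real \<Rightarrow> real \<Rightarrow> real \<Rightarrow> real \<Rightarrow> point_state list \<Rightarrow> (point_state list \<times> real) timed" where
  "second_round L r a d [] = do { tick; return ([], d) }"
| "second_round L r a d ((x, p, m) # ps) = do {
     tick;
     g \<leftarrow> cw_dist_t L a p;
     near \<leftarrow> le_t g r;
     (p', m', d1) \<leftarrow>
       (if near then return (p, m, d)
        else do {
          p' \<leftarrow> add_mod_t L a r;
          h \<leftarrow> cw_dist_t L a x;
          e \<leftarrow> sub_t h r;
          d1 \<leftarrow> max_t d e;
          s \<leftarrow> cw_dist_t L p' p;
          m' \<leftarrow> add_t m s;
          return (p', m', d1) });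
     same2 \<leftarrow> eq_t p' p;
     same1 \<leftarrow> eq_t p x;
     if same2 \<and> same1 then return ((x, p', m') # ps, d1)
     else do {
       (qs, d') \<leftarrow> second_round L r p' d1 ps;
       return ((x, p', m') # qs, d') } }"

fun moving_stage :: "real \<Rightarrow> real \<Rightarrow> real list \<Rightarrow> (point_state list \<times> real) timed" where
  "moving_stage L r [] = do { tick; return ([], 0) }"
| "moving_stage L r (x # xs) = do {
     tick;
     (ps, last, d) \<leftarrow> first_round L r x 0 xs;
     g \<leftarrow> cw_dist_t L last x;
     near \<leftarrow> le_t g r;
     if near then return ((x, x, 0) # ps, d)
     else do {
       p \<leftarrow> add_mod_t L last r;
       e \<leftarrow> sub_t g r;
       d1 \<leftarrow> max_t d e;
       m \<leftarrow> cw_dist_t L p x;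
       (qs, d') \<leftarrow> second_round L r p d1 ps;
       return ((x, p, m) # qs, d') } }"

fun shift_all :: "real \<Rightarrow> point_state list \<Rightarrow> real list timed" where
  "shift_all h [] = do { tick; return [] }"
| "shift_all h ((x, p, m) # ps) = do {
     tick;
     e \<leftarrow> sub_t h m;
     es \<leftarrow> shift_all h ps;
     return (e # es) }"

definition cycle_algorithm :: "real \<Rightarrow> real \<Rightarrow> real list \<Rightarrow> real list timed" where
  "cycle_algorithm L r xs = do {
     (ps, d) \<leftarrow> moving_stage L r xs;
     h \<leftarrow> div_t d 2;
     shift_all h ps }"

end

theory Submission
  imports Defs
begin

text \<open>
  Unroll the cycle, \<open>X (j + n) = X j + L\<close>, and let \<open>y\<close> be the greedy sequence
  \<open>y (j + 1) = min (X (j + 1)) (y j + r)\<close>. The two rounds compute \<open>y\<close> on two successive turns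
  modulo \<open>L\<close>, and \<open>d\<^sub>m\<^sub>a\<^sub>x\<close> is the maximum of the deficits \<open>X j - y j\<close>.
  The assumption \<open>L \<le> n * r\<close> ensures that no third turn is needed. As \<open>y j\<close> has the form
  \<open>X k + (j - k) * r\<close> with \<open>k \<le> j\<close>, in every solution the displacements of the points at \<open>k\<close> and
  \<open>j\<close> differ by at least \<open>X j - y j\<close>, so one of them is at least half of that; shifting by
  \<open>d\<^sub>m\<^sub>a\<^sub>x / 2\<close> attains this bound.
\<close>

section \<open>Clockwise distances between residues\<close>

lemma rmod_add_modulus: "(a + m) rmod m = a rmod (m :: real)"
  using rmod_add[of a m m] by simp

lemma rmod_add_left: "(a rmod m + b) rmod m = (a + b) rmod m"
  by (metis rmod_add rmod_rmod)

text \<open>Passing from \<open>A\<close> to \<open>B\<close> crosses the origin at most once, and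
  the second branch of \<open>cw_dist\<close> adds the lost \<open>L\<close> back. This turns the
  distances computed on the cycle into differences on the unrolled line.\<close>

lemma cw_dist_rmod:
  assumes "0 < L" "A \<le> B" "B < A + L"
  shows "cw_dist L (A rmod L) (B rmod L) = B - A"
proof -
  define a where "a = A rmod L"
  have a: "0 \<le> a" "a < L" using assms by (auto simp: a_def rmod_less rmod_nonneg)
  have "B rmod L = (A + (B - A)) rmod L" by simp
  also have "\<dots> = (a + (B - A)) rmod L" unfolding a_def by (simp only: rmod_add_left)
  also have "\<dots> = (if L \<le> a + (B - A) then a + (B - A) - L else a + (B - A))"
  proof (cases "L \<le> a + (B - A)")
    case True
    have "(a + (B - A)) rmod L = a + (B - A) - L"
      by (rule rmod_unique[where n = 1]) (use assms a True in auto)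
    with True show ?thesis by simp
  next
    case False
    have "(a + (B - A)) rmod L = a + (B - A)"
      by (rule rmod_unique[where n = 0]) (use assms a False in auto)
    with False show ?thesis by simp
  qed
  finally show ?thesis
    using assms a by (auto simp: cw_dist_def a_def[symmetric])
qed

section \<open>Unrolling the cycle\<close>

locale instance_on_cycle =
  fixes n :: nat and L r :: real and xs :: "real list"
  assumes inst: "cycle_instance n L r xs"
begin

lemma r_pos: "0 < r" and L_pos: "0 < L" and L_le: "L \<le> real n * r" and len: "length xs = n"
  and xs0: "xs ! 0 = 0" and xs_mono: "i < j \<Longrightarrow> j < n \<Longrightarrow> xs ! i < xs ! j"
  and xs_less: "i < n \<Longrightarrow> xs ! i < L"
  using inst by (auto simp: cycle_instance_def sorted_wrt_iff_nth_less)

lemma n_pos: "0 < n"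
  using L_pos L_le by (cases n) auto

lemma xs_nonneg: "i < n \<Longrightarrow> 0 \<le> xs ! i"
  using xs_mono[of 0 i] xs0 by (cases i) auto

definition unroll :: "(nat \<Rightarrow> real) \<Rightarrow> nat \<Rightarrow> real" where
  "unroll f j = f (j mod n) + L * real (j div n)"

lemma unroll_less: "j < n \<Longrightarrow> unroll f j = f j"
  by (simp add: unroll_def)

lemma unroll_add: "unroll f (n + j) = unroll f j + L"
  using n_pos by (simp add: unroll_def algebra_simps)

text \<open>Up to periodicity there are only \<open>n\<close> consecutive gaps: those inside one
  turn and the closing one. The lemma serves both for the input points and for an arbitrary
  solution.\<close>

lemma unroll_step:
  assumes "\<And>i. Suc i < n \<Longrightarrow> P (f (Suc i) - f i)" "P (f 0 + L - f (n - 1))"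
  shows "P (unroll f (Suc j) - unroll f j)"
proof (cases "Suc (j mod n) < n")
  case True
  then have "Suc j mod n = Suc (j mod n)" "Suc j div n = j div n"
    by (auto simp: mod_Suc div_Suc)
  with assms(1)[OF True] show ?thesis by (simp add: unroll_def)
next
  case False
  with n_pos have m: "j mod n = n - 1"
    by (metis Suc_lessI diff_Suc_1 mod_less_divisor)
  then have "Suc j mod n = 0" "Suc j div n = Suc (j div n)"
    using n_pos by (auto simp: mod_Suc div_Suc)
  with assms(2) m show ?thesis by (simp add: unroll_def algebra_simps)
qed

abbreviation "X \<equiv> unroll ((!) xs)"

lemma X_strict_mono: "strict_mono X"
proof (rule strict_mono_Suc_iff[THEN iffD2], intro allI)
  fix j
  have "0 < X (Suc j) - X j"
    by (rule unroll_step[where P = "\<lambda>d. 0 < d"])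
      (use xs_mono xs_less[of "n - 1"] n_pos xs0 in auto)
  then show "X j < X (Suc j)" by simp
qed

lemma X_rmod: "j < n \<Longrightarrow> X j rmod L = X j"
  using xs_nonneg[of j] xs_less[of j] by (auto simp: unroll_less intro!: rmod_idem)

section \<open>The greedy sequence over two turns\<close>

primrec y :: "nat \<Rightarrow> real" where
  "y 0 = 0"
| "y (Suc j) = min (X (Suc j)) (y j + r)"

lemma X_0: "X 0 = 0"
  using n_pos xs0 by (simp add: unroll_less)

lemma y_le_X: "y j \<le> X j"
  by (cases j) (auto simp: X_0)

lemma y_strict_mono: "strict_mono y"
proof (rule strict_mono_Suc_iff[THEN iffD2], intro allI)
  fix j
  have "X j < X (Suc j)" using X_strict_mono by (simp add: strict_mono_Suc_iff)
  with y_le_X[of j] r_pos show "y j < y (Suc j)" by simp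
qed

lemma y_nonneg: "0 \<le> y j"
  using strict_mono_mono[OF y_strict_mono, THEN monoD, of 0 j] by simp

lemma y_rmod: "j < n \<Longrightarrow> y j rmod L = y j"
  using y_nonneg[of j] y_le_X[of j] xs_less[of j] by (auto simp: unroll_less intro!: rmod_idem)

text \<open>Together with \<open>y_eq\<close> this gives a closed form: \<open>y j\<close> is the
  minimum of \<open>X k + (j - k) * r\<close> over all \<open>k \<le> j\<close>.\<close>

lemma y_le: "k \<le> j \<Longrightarrow> y j \<le> X k + real (j - k) * r"
proof (induction j rule: dec_induct)
  case base
  then show ?case using y_le_X by simp
next
  case (step j)
  then show ?case by (auto simp: Suc_diff_le algebra_simps)
qed

text \<open>The witness is the last index up to \<open>j\<close> at which \<open>y\<close> and
  \<open>X\<close> agree; after it every step advances by exactly \<open>r\<close>.\<close>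

lemma y_eq: "\<exists>k\<le>j. y j = X k + real (j - k) * r"
proof (induction j)
  case 0
  then show ?case by (auto simp: X_0)
next
  case (Suc j)
  then obtain k where k: "k \<le> j" "y j = X k + real (j - k) * r" by blast
  show ?case
  proof (cases "X (Suc j) \<le> y j + r")
    case True
    then show ?thesis by (intro exI[of _ "Suc j"]) auto
  next
    case False
    with k show ?thesis by (intro exI[of _ k]) (auto simp: Suc_diff_le algebra_simps)
  qed
qed

lemma y_period_le: "y (n + j) \<le> y j + L"
proof (induction j)
  case 0
  show ?case using y_le_X[of n] unroll_add[of "(!) xs" 0] by (simp add: X_0)
next
  case (Suc j)
  then show ?case using unroll_add[of "(!) xs" "Suc j"] by auto
qed

text \<open>The second round measures against the position left by the first round, not the initial
  one. Replacing \<open>X\<close> by \<open>y\<close> only adds the term \<open>y j + r + L\<close>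
  to the minimum, and \<open>y_period_le\<close> makes this term redundant.\<close>

lemma y_second_Suc: "y (Suc (n + j)) = min (y (Suc j) + L) (y (n + j) + r)"
  using y_period_le[of j] unroll_add[of "(!) xs" "Suc j"] by auto

text \<open>The recursion commutes with the shift by one turn, so two turns that agree once agree
  from then on. This justifies stopping the second round early.\<close>

lemma y_period_from:
  assumes "y k + L = y (n + k)" "k \<le> j"
  shows "y (n + j) = y j + L"
  using assms(2)
proof (induction j rule: dec_induct)
  case base
  then show ?case using assms by simp
next
  case (step j)
  then show ?case using unroll_add[of "(!) xs" "Suc j"] by auto
qed

text \<open>The closing gap after two turns is at most \<open>r\<close>. If the term attaining the
  minimum has \<open>k \<le> n\<close>, then \<open>n\<close> of its steps of length
  \<open>r\<close> cover \<open>L\<close>; otherwise the term is moved back by one turn and bounds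
  \<open>y n\<close>.\<close>

lemma y_wrap: "y n + L \<le> y (n + (n - 1)) + r"
proof -
  obtain k where k: "k \<le> n + (n - 1)" "y (n + (n - 1)) = X k + real (n + (n - 1) - k) * r"
    using y_eq by blast
  show ?thesis
  proof (cases "k \<le> n")
    case True
    have steps: "real (n + (n - 1) - k) = real n + real (n - k) - 1"
      using True n_pos by simp
    have "y (n + (n - 1)) + r = X k + real (n - k) * r + real n * r"
      unfolding k(2) steps by (simp add: algebra_simps)
    with y_le[OF True] L_le show ?thesis by simp
  next
    case False
    define i where "i = k - n"
    have i: "k = n + i" "i \<le> n" using False k n_pos by (auto simp: i_def)
    have "real (n + (n - 1) - k) = real (n - i) - 1"
      using i n_pos k by simp
    then have "y (n + (n - 1)) + r = X i + real (n - i) * r + L"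
      using k(2) unroll_add[of "(!) xs" i] i(1) by (simp add: algebra_simps)
    with y_le[OF i(2)] show ?thesis by simp
  qed
qed

text \<open>In the second round the distance to the initial coordinate must stay below a full turn
  for \<open>cw_dist_rmod\<close> to apply; this is the bound needed there.\<close>

lemma X_Suc_less_y:
  assumes "Suc i < n"
  shows "X (Suc i) < y (n + i)"
proof -
  obtain k where k: "k \<le> n + i" "y (n + i) = X k + real (n + i - k) * r"
    using y_eq by blast
  \<comment> \<open>For small \<open>k\<close> the \<open>n\<close> steps of length \<open>r\<close>
    already exceed every coordinate; for \<open>k = Suc i\<close> there remain
    \<open>n - 1 > 0\<close> steps; for larger \<open>k\<close> the term starts beyond
    \<open>X (Suc i)\<close>.\<close>
  consider "k \<le> i" | "k = Suc i" | "Suc i < k" by linarith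
  then show ?thesis
  proof cases
    case 1
    have "real (n + i - k) * r = real n * r + real (i - k) * r"
      using 1 by (simp add: algebra_simps)
    moreover have "0 \<le> X k" "0 \<le> real (i - k) * r"
      using order_trans[OF y_nonneg y_le_X] r_pos by auto
    ultimately show ?thesis
      using k(2) L_le xs_less[OF assms] assms by (simp add: unroll_less)
  next
    case 2
    with assms r_pos k show ?thesis by simp
  next
    case 3
    then have "X (Suc i) < X k" using X_strict_mono by (simp add: strict_mono_less)
    moreover have "0 \<le> real (n + i - k) * r" using r_pos by simp
    ultimately show ?thesis using k(2) by linarith
  qed
qed

section \<open>Deficits and their running maximum\<close>

definition deficit :: "nat \<Rightarrow> real" where
  "deficit j = X j - y j"

definition max_deficit :: "nat \<Rightarrow> real" where
  "max_deficit j = Max (deficit ` {..j})"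

lemma max_deficit_0: "max_deficit 0 = 0"
  by (simp add: max_deficit_def deficit_def X_0)

lemma max_deficit_Suc: "max_deficit (Suc j) = max (max_deficit j) (deficit (Suc j))"
  by (simp add: max_deficit_def atMost_Suc max.commute)

lemma deficit_le: "i \<le> j \<Longrightarrow> deficit i \<le> max_deficit j"
  by (simp add: max_deficit_def)

lemma deficit_nonneg: "0 \<le> deficit j"
  by (simp add: deficit_def y_le_X)

lemma max_deficit_nonneg: "0 \<le> max_deficit j"
  using order_trans[OF deficit_nonneg deficit_le[of j j]] by simp

lemma deficit_period_from:
  assumes "y k + L = y (n + k)" "k \<le> j"
  shows "deficit (n + j) = deficit j"
  using y_period_from[OF assms] by (simp add: deficit_def unroll_add)

text \<open>Once the turns agree, each further deficit repeats one of the first turn, which the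
  maximum already includes. Hence the running maximum is final when the second round stops.\<close>

lemma max_deficit_period_from:
  assumes k: "y k + L = y (n + k)" and i: "k \<le> Suc i" "i < n" and j: "i \<le> j" "j < n"
  shows "max_deficit (n + j) = max_deficit (n + i)"
  using j
proof (induction j rule: dec_induct)
  case (step j)
  have "deficit (n + Suc j) = deficit (Suc j)"
    by (rule deficit_period_from[OF k]) (use step i in auto)
  also have "\<dots> \<le> max_deficit (n + j)"
    by (rule deficit_le) (use step in auto)
  finally show ?case using step by (simp add: max_deficit_Suc)
qed simp

section \<open>The two rounds compute the greedy sequence\<close>

definition state :: "nat \<Rightarrow> point_state" where
  "state j = (X j rmod L, y j rmod L, deficit j)"

lemma state_period_from:
  assumes "y k + L = y (n + k)" "k \<le> j"
  shows "state (n + j) = state j"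
  using y_period_from[OF assms] deficit_period_from[OF assms]
  by (simp add: state_def unroll_add rmod_add_modulus)

text \<open>In the first turn all positions lie in \<open>[0, L)\<close> and
  \<open>y i \<le> X (Suc i)\<close>, so every clockwise distance is a plain difference.\<close>

lemma val_first_round:
  assumes "i \<le> n - 1"
  shows "val (first_round L r (y i) (max_deficit i) (drop (Suc i) xs)) =
    (map state [Suc i..<n], y (n - 1), max_deficit (n - 1))"
  using assms
proof (induction i rule: inc_induct)
  case base
  then show ?case using n_pos len by simp
next
  case (step i)
  then have i: "Suc i < n" by simp
  have drop: "drop (Suc i) xs = X (Suc i) # drop (Suc (Suc i)) xs"
    using i len by (simp add: Cons_nth_drop_Suc unroll_less)
  have upt: "[Suc i..<n] = Suc i # [Suc (Suc i)..<n]"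
    using i by (simp add: upt_conv_Cons)
  have gap: "cw_dist L (y i) (X (Suc i)) = X (Suc i) - y i"
    using y_le_X[of i] X_strict_mono
    by (simp add: cw_dist_def strict_mono_Suc_iff order_trans less_imp_le)
  have st: "state (Suc i) = (X (Suc i), y (Suc i), deficit (Suc i))"
    using i by (simp add: state_def X_rmod y_rmod del: y.simps)
  show ?case
  proof (cases "X (Suc i) - y i \<le> r")
    case True
    then have y: "y (Suc i) = X (Suc i)" by simp
    then have "max_deficit (Suc i) = max_deficit i"
      using max_deficit_nonneg by (simp add: max_deficit_Suc deficit_def max_absorb1)
    with True y step.IH show ?thesis
      by (simp add: drop upt val_cw_dist_t gap st deficit_def del: y.simps upt_Suc)
  next
    case False
    then have y: "y (Suc i) = y i + r" by simp
    then have "max_deficit (Suc i) = max (max_deficit i) (X (Suc i) - y i - r)"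
      by (simp add: max_deficit_Suc deficit_def algebra_simps)
    moreover have "cw_dist L (y i + r) (X (Suc i)) = deficit (Suc i)"
      using False y by (simp add: cw_dist_def deficit_def)
    ultimately show ?thesis using False y step.IH
      by (simp add: drop upt val_cw_dist_t val_max_t gap st del: y.simps upt_Suc)
  qed
qed

definition d_max :: real where
  "d_max = max_deficit (n + (n - 1))"

text \<open>If the gap is at most \<open>r\<close>, both turns agree from this index on, so stopping
  and continuing give the same result. Otherwise the point moves to \<open>?a + r\<close> and the
  round goes on.\<close>

lemma val_second_round:
  assumes "i \<le> n - 1"
  shows "val (second_round L r (y (n + i) rmod L) (max_deficit (n + i)) (map state [Suc i..<n])) =
    (map (\<lambda>j. state (n + j)) [Suc i..<n], d_max)"
  using assms
proof (induction i rule: inc_induct)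
  case base
  then show ?case using n_pos by (simp add: d_max_def)
next
  case (step i)
  then have i: "Suc i < n" by simp
  let ?a = "y (n + i)" and ?p = "y (Suc i)" and ?p' = "y (n + Suc i)"
  have upt: "[Suc i..<n] = Suc i # [Suc (Suc i)..<n]"
    using i by (simp add: upt_conv_Cons)
  have X: "X (n + Suc i) = X (Suc i) + L" by (rule unroll_add)
  have mono: "y j < y k" if "j < k" for j k
    using y_strict_mono that by (simp add: strict_mono_less)
  have p: "?p < ?a" using mono[of "Suc i" "n + i"] i by simp
  have a: "?a < ?p + L" using y_period_le[of i] mono[of i "Suc i"] by linarith
  have p': "?p' = min (?p + L) (?a + r)" using y_second_Suc[of i] by simp
  have gap: "cw_dist L (?a rmod L) (?p rmod L) = ?p + L - ?a"
    using cw_dist_rmod[OF L_pos, of ?a "?p + L"] p a by (simp add: rmod_add_modulus del: y.simps)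
  have gapX: "cw_dist L (?a rmod L) (X (Suc i) rmod L) = X (n + Suc i) - ?a"
    using cw_dist_rmod[OF L_pos, of ?a "X (Suc i) + L"] X_Suc_less_y[OF i] y_le_X[of "Suc i"] a X
    by (simp add: rmod_add_modulus del: y.simps)
  show ?case
  proof (cases "?p + L - ?a \<le> r")
    case True
    then have per: "y (Suc i) + L = y (n + Suc i)" using p' by simp
    have st: "state (n + Suc i) = state (Suc i)" by (rule state_period_from[OF per]) simp
    have D: "max_deficit (n + Suc i) = max_deficit (n + i)"
      by (rule max_deficit_period_from[OF per]) (use i in auto)
    have D': "d_max = max_deficit (n + i)" unfolding d_max_def
      by (rule max_deficit_period_from[OF per]) (use i in auto)
    have rest: "map (\<lambda>j. state (n + j)) [Suc (Suc i)..<n] = map state [Suc (Suc i)..<n]"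
      by (rule map_cong) (auto intro!: state_period_from[OF per])
    have pp: "?p' rmod L = ?p rmod L" using per by (metis rmod_add_modulus)
    show ?thesis
    \<comment> \<open>The new and old residues coincide here, so the stopping test reduces to
      whether the first round left the point in place.\<close>
    proof (cases "?p rmod L = X (Suc i) rmod L")
      case eq: True
      show ?thesis unfolding upt list.map rest st
        using True eq D'
        by (simp add: state_def[of "Suc i"] val_cw_dist_t gap[unfolded eq] del: y.simps upt_Suc)
    next
      case False
      then show ?thesis unfolding upt list.map st
        using True step.IH D pp
        by (simp add: state_def[of "Suc i"] val_cw_dist_t gap del: y.simps upt_Suc)
    qed
  next
    case False
    then have y: "?p' = ?a + r" using p' by simp
    have r: "r < L" using False p by simp
    have add: "val (add_mod_t L (?a rmod L) r) = ?p' rmod L"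
      using L_pos r r_pos y
      by (simp add: val_add_mod_t rmod_less rmod_nonneg rmod_add_left del: y.simps)
    have s: "cw_dist L (?p' rmod L) (?p rmod L) = ?p + L - ?p'"
      using cw_dist_rmod[OF L_pos, of ?p' "?p + L"] p y False r_pos
      by (simp add: rmod_add_modulus del: y.simps)
    \<comment> \<open>A point moved in this round cannot pass the stopping test.\<close>
    have ne: "?p' rmod L \<noteq> ?p rmod L"
    proof
      assume "?p' rmod L = ?p rmod L"
      then have "cw_dist L (?p' rmod L) (?p rmod L) = 0" by (simp add: cw_dist_def)
      with s y False show False by linarith
    qed
    \<comment> \<open>The algorithm measures from the initial coordinate, so the new candidate is
      the total displacement over both rounds.\<close>
    have D: "max (max_deficit (n + i)) (X (n + Suc i) - ?a - r) = max_deficit (n + Suc i)"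
      using y by (simp add: max_deficit_Suc deficit_def algebra_simps del: y.simps)
    have m: "deficit (Suc i) + (?p + L - ?p') = deficit (n + Suc i)"
      using X by (simp add: deficit_def del: y.simps)
    have st: "state (n + Suc i) = (X (Suc i) rmod L, ?p' rmod L, deficit (n + Suc i))"
      by (simp only: state_def X rmod_add_modulus)
    show ?thesis unfolding upt list.map st
      using False step.IH ne
      by (simp add: state_def[of "Suc i"] val_cw_dist_t val_max_t gap gapX add s D m
          del: y.simps upt_Suc add_Suc_right)
  qed
qed

lemma val_moving_stage:
  "val (moving_stage L r xs) = (map (\<lambda>j. state (n + j)) [0..<n], d_max)"
proof -
  obtain x xs' where xs: "xs = x # xs'" using n_pos len by (cases xs) auto
  have x: "x = 0" and xs': "xs' = drop (Suc 0) xs" using xs xs0 by auto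
  have upt: "[0..<n] = 0 # [Suc 0..<n]"
    using n_pos by (simp add: upt_conv_Cons)
  have first: "val (first_round L r x 0 xs') =
      (map state [Suc 0..<n], y (n - 1), max_deficit (n - 1))"
    using val_first_round[of 0] x xs' by (simp add: max_deficit_0)
  have Xn: "X n = L" using unroll_add[of "(!) xs" 0] by (simp add: X_0)
  have yn: "y n = min L (y (n - 1) + r)"
    using y.simps(2)[of "n - 1"] n_pos Xn by simp
  have ylt: "y (n - 1) < L" using y_le_X[of "n - 1"] xs_less[of "n - 1"] n_pos
    by (simp add: unroll_less)
  have state0: "state 0 = (0, 0, 0)"
    using n_pos L_pos by (simp add: state_def X_0 deficit_def)
  \<comment> \<open>A single point has clockwise distance 0 to itself, not \<open>L\<close>. This is
    harmless, since \<open>n = 1\<close> forces \<open>L \<le> r\<close>.\<close>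
  have gap: "cw_dist L (y (n - 1)) 0 = (if n = 1 then 0 else L - y (n - 1))"
  proof (cases "n = 1")
    case False
    then have "y 0 < y (n - 1)"
      using n_pos by (intro strict_monoD[OF y_strict_mono]) simp
    with False show ?thesis by (simp add: cw_dist_def)
  next
    case True
    then have "n - 1 = 0" by simp
    then have "y (n - 1) = 0" by (simp only: y.simps)
    then show ?thesis using True by (simp add: cw_dist_def)
  qed
  show ?thesis
  proof (cases "L - y (n - 1) \<le> r")
    case True
    then have per: "y 0 + L = y (n + 0)" using yn by simp
    have st: "state (n + j) = state j" for j by (rule state_period_from[OF per]) simp
    have D1: "d_max = max_deficit (n + 0)" unfolding d_max_def
      by (rule max_deficit_period_from[OF per]) (use n_pos in auto)
    have D0: "deficit (n + 0) = 0"
      using per Xn by (simp add: deficit_def)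
    then have "max_deficit n = max_deficit (n - 1)"
      using max_deficit_Suc[of "n - 1"] n_pos max_deficit_nonneg[of "n - 1"] by simp
    then have D: "d_max = max_deficit (n - 1)" using D1 by simp
    have near: "cw_dist L (y (n - 1)) 0 \<le> r" using True r_pos gap by simp
    show ?thesis unfolding upt list.map st D state0
      using near first x by (simp add: xs val_cw_dist_t state0 del: upt_Suc)
  next
    case False
    have n1: "n \<noteq> 1"
    proof
      assume "n = 1"
      then have "real n * r = r" by simp
      with L_le False y_nonneg[of "n - 1"] show False by linarith
    qed
    have y: "y n = y (n - 1) + r" using yn False by simp
    have r: "r < L" using False y_nonneg[of "n - 1"] by simp
    have yr: "y n rmod L = y n" using y y_nonneg[of n] False
      by (intro rmod_idem) auto
    have add: "val (add_mod_t L (y (n - 1)) r) = y n rmod L"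
      using y r r_pos y_nonneg ylt by (simp add: val_add_mod_t)
    have m: "cw_dist L (y n) 0 = deficit n"
      using y y_nonneg[of "n - 1"] r_pos Xn by (simp add: cw_dist_def deficit_def)
    have D: "max (max_deficit (n - 1)) (L - y (n - 1) - r) = max_deficit n"
      using max_deficit_Suc[of "n - 1"] n_pos y Xn by (simp add: deficit_def diff_diff_eq)
    have st: "state (n + 0) = (0, y n rmod L, deficit n)"
      using unroll_add[of "(!) xs" 0] L_pos by (simp add: state_def X_0)
    have near: "\<not> cw_dist L (y (n - 1)) 0 \<le> r" using False gap n1 by simp
    show ?thesis unfolding upt list.map st
      using near first x val_second_round[of 0] gap n1 D m yr add
      by (simp add: xs val_cw_dist_t val_max_t del: upt_Suc)
  qed
qed

section \<open>Feasibility and optimality of the output\<close>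

lemma val_shift_all: "val (shift_all h ps) = map (\<lambda>(x, p, m). h - m) ps"
  by (induction h ps rule: shift_all.induct) auto

lemma val_algorithm:
  "val (cycle_algorithm L r xs) = map (\<lambda>j. d_max / 2 - deficit (n + j)) [0..<n]"
  by (simp add: cycle_algorithm_def val_moving_stage val_shift_all state_def)

text \<open>The final positions are the second turn of \<open>y\<close> up to a common shift, so
  only increments of \<open>y\<close> and the closing gap matter.\<close>

lemma solution_algorithm: "cycle_solution L r xs (val (cycle_algorithm L r xs))"
proof -
  have pos: "xs ! i + val (cycle_algorithm L r xs) ! i = y (n + i) - L + d_max / 2" if "i < n" for i
    using that by (simp add: val_algorithm deficit_def unroll_add unroll_less)
  have step: "y j \<le> y (Suc j)" "y (Suc j) \<le> y j + r" for j
    using y_strict_mono by (auto simp: strict_mono_Suc_iff less_imp_le simp del: y.simps(2)) simp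
  have "y (n + (n - 1)) \<le> y n + L"
    using step(1)[of "n + (n - 1)"] y_period_le[of n] n_pos by (simp del: y.simps)
  then have wrap: "0 \<le> y n + L - y (n + (n - 1)) \<and> y n + L - y (n + (n - 1)) \<le> r"
    using y_wrap by linarith
  have "0 \<le> y (n + (i + 1)) - y (n + i) \<and> y (n + (i + 1)) - y (n + i) \<le> r" for i
    using step[of "n + i"] by (simp del: y.simps)
  with wrap pos[of 0] pos[of "n - 1"] n_pos len show ?thesis
    by (simp add: cycle_solution_def Let_def pos val_algorithm[THEN arg_cong, of length]
        del: y.simps add_Suc_right)
qed

text \<open>Unrolled to \<open>w\<close>, a solution gains at most \<open>r\<close> per index, so
  between \<open>k\<close> and \<open>j\<close> at most what separates \<open>y j\<close> from
  \<open>X k\<close>. What remains is a difference of two displacements.\<close>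

lemma deficit_lower_bound:
  assumes "cycle_solution L r xs ds"
  shows "deficit j \<le> 2 * max_moving_distance ds"
proof -
  define w where "w = unroll (\<lambda>i. xs ! i + ds ! i)"
  have lds: "length ds = n" using assms len by (simp add: cycle_solution_def)
  have w: "w i = X i + ds ! (i mod n)" for i
    by (simp add: w_def unroll_def)
  have bound: "\<bar>ds ! (i mod n)\<bar> \<le> max_moving_distance ds" for i
    unfolding max_moving_distance_def using lds n_pos by (intro Max_ge) auto
  have "w (Suc i) - w i \<le> r" for i
    unfolding w_def by (rule unroll_step[where P = "\<lambda>d. d \<le> r"])
      (use assms len in \<open>auto simp: cycle_solution_def Let_def\<close>)
  then have step: "w (Suc i) \<le> w i + r" for i by (simp add: algebra_simps)
  obtain k where k: "k \<le> j" "y j = X k + real (j - k) * r" using y_eq by blast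
  have "w j \<le> w k + real (j - k) * r" using k(1)
  proof (induction j rule: dec_induct)
    case (step j)
    then show ?case using \<open>\<And>i. w (Suc i) \<le> w i + r\<close>[of j]
      by (simp add: Suc_diff_le algebra_simps)
  qed simp
  then have "deficit j \<le> ds ! (k mod n) - ds ! (j mod n)"
    using k(2) by (simp add: w deficit_def)
  with bound[of k] bound[of j] show ?thesis by linarith
qed

text \<open>Second-turn deficits lie between 0 and \<open>d_max\<close>, so centring them costs at
  most \<open>d_max / 2\<close>; the lower bound holds for every deficit of either turn, hence for
  their maximum.\<close>

lemma optimal_algorithm: "optimal_solution L r xs (val (cycle_algorithm L r xs))"
proof -
  have "max_moving_distance (val (cycle_algorithm L r xs)) \<le> d_max / 2"
  proof -
    have "\<bar>d_max / 2 - deficit (n + j)\<bar> \<le> d_max / 2" if "j < n" for j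
    proof -
      have "deficit (n + j) \<le> d_max" unfolding d_max_def by (rule deficit_le) (use that in simp)
      with deficit_nonneg[of "n + j"] show ?thesis by linarith
    qed
    then show ?thesis
      using n_pos unfolding max_moving_distance_def val_algorithm by (subst Max_le_iff) auto
  qed
  moreover have "d_max / 2 \<le> max_moving_distance ds" if "cycle_solution L r xs ds" for ds
  proof -
    have "d_max \<le> 2 * max_moving_distance ds"
      unfolding d_max_def max_deficit_def
      by (subst Max_le_iff) (auto intro: deficit_lower_bound[OF that])
    then show ?thesis by simp
  qed
  ultimately show ?thesis
    using solution_algorithm unfolding optimal_solution_def is_arg_min_linorder
    by (meson order_trans)
qed

end

section \<open>Running time\<close>

lemma steps_cw_dist_t: "steps (cw_dist_t L a b) \<le> 3"
  by (simp add: cw_dist_t_def)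

lemma steps_max_t: "steps (max_t a b) = 1"
  by (simp add: max_t_def)

lemma steps_add_mod_t: "steps (add_mod_t L a b) \<le> 3"
  by (simp add: add_mod_t_def)

text \<open>The output length is carried along because the cost of the next pass depends on
  it.\<close>

lemma first_round_bounds:
  "steps (first_round L r a d xs) \<le> 11 * length xs + 1 \<and>
   length (fst (val (first_round L r a d xs))) = length xs"
proof (induction xs arbitrary: a d)
  case (Cons x xs)
  have "steps (cw_dist_t L a x) \<le> 3" "steps (cw_dist_t L (a + r) x) \<le> 3"
    by (rule steps_cw_dist_t)+
  then show ?case
    using Cons[of x d] Cons[of "a + r" "max d (val (cw_dist_t L a x) - r)"]
    by (simp add: steps_max_t val_max_t case_prod_beta)
qed simp

lemma second_round_bounds:
  "steps (second_round L r a d ps) \<le> 20 * length ps + 1 \<and>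
   length (fst (val (second_round L r a d ps))) = length ps"
proof (induction ps arbitrary: a d)
  case (Cons q ps)
  obtain x p m where q: "q = (x, p, m)" by (rule prod_cases3)
  let ?p' = "val (add_mod_t L a r)"
  have "steps (cw_dist_t L a p) \<le> 3" "steps (cw_dist_t L a x) \<le> 3"
    "steps (cw_dist_t L ?p' p) \<le> 3" "steps (add_mod_t L a r) \<le> 3"
    by (rule steps_cw_dist_t steps_add_mod_t)+
  then show ?case
    using Cons[of p d] Cons[of ?p' "max d (val (cw_dist_t L a x) - r)"]
    by (auto simp: q steps_max_t val_max_t case_prod_beta)
qed simp

lemma moving_stage_bounds:
  "steps (moving_stage L r xs) \<le> 31 * length xs + 20 \<and>
   length (fst (val (moving_stage L r xs))) = length xs"
proof (cases xs)
  case (Cons x xs')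
  obtain ps l d where f: "val (first_round L r x 0 xs') = (ps, l, d)" by (metis prod_cases3)
  have "steps (cw_dist_t L l x) \<le> 3" "steps (cw_dist_t L (val (add_mod_t L l r)) x) \<le> 3"
    "steps (add_mod_t L l r) \<le> 3"
    by (rule steps_cw_dist_t steps_add_mod_t)+
  moreover note first_round_bounds[of L r x 0 xs']
    second_round_bounds[of L r "val (add_mod_t L l r)" "max d (val (cw_dist_t L l x) - r)" ps]
  ultimately show ?thesis
    by (auto simp: Cons f steps_max_t val_max_t split: prod.splits)
qed simp

lemma steps_shift_all: "steps (shift_all h ps) = 2 * length ps + 1"
  by (induction h ps rule: shift_all.induct) auto

lemma steps_cycle_algorithm: "steps (cycle_algorithm L r xs) \<le> 33 * length xs + 22"
  using moving_stage_bounds[of L r xs]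
  by (auto simp: cycle_algorithm_def steps_shift_all split: prod.splits)

theorem theorem2:
  shows "(\<forall>n L r xs. cycle_instance n L r xs \<longrightarrow>
            optimal_solution L r xs (val (cycle_algorithm L r xs))) \<and>
         (\<exists>T :: nat \<Rightarrow> real. T \<in> O(\<lambda>n. real n) \<and>
            (\<forall>n L r xs. cycle_instance n L r xs \<longrightarrow>
               real (steps (cycle_algorithm L r xs)) \<le> T n))"
proof (intro conjI allI impI exI[where x = "\<lambda>n. 55 * real n"])
  fix n L r xs assume inst: "cycle_instance n L r xs"
  then interpret instance_on_cycle n L r xs by unfold_locales
  show "optimal_solution L r xs (val (cycle_algorithm L r xs))"
    by (rule optimal_algorithm)
  \<comment> \<open>Here \<open>55 = 33 + 22\<close>; the additive constant is absorbed because
    \<open>n\<close> is positive.\<close>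
  have "steps (cycle_algorithm L r xs) \<le> 55 * n"
    using steps_cycle_algorithm[of L r xs] len n_pos by simp
  then show "real (steps (cycle_algorithm L r xs)) \<le> 55 * real n"
    by (metis of_nat_le_iff of_nat_mult of_nat_numeral)
qed simp

end
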